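(* Let $\sigma_1,\sigma_2,\sigma_3,\sigma_4\ge 0$ be real numbers, let $S_0=\mathrm{diag}(\sigma_1,\sigma_2,\sigma_3,\sigma_4)$, and let $\mathcal{F}$ be the associated frequency mapping, which sends each positive hermitian structure $J$ on $\mathbb{R}^4$ to the ordered pair $(\nu_1,\nu_2)$, $\nu_1\ge\nu_2$, of frequencies of $S_0J+JS_0$. Then the image of $\mathcal{F}$ coincides with the image $\mathcal{A}$ under $\mathcal{F}$ of the set of adapted hermitian structures; that is, for every positive hermitian structure $J$ on $\mathbb{R}^4$ there exists an adapted hermitian structure $J'$ with $\mathcal{F}(J')=\mathcal{F}(J)$.
   Context: Let $p\ge 1$, and let $\mathbb{R}^{2p}$ carry its standard euclidean structure and canonical orthonormal basis $e_1,\dots,e_{2p}$ (here $p=2$). Set $J_0=\begin{pmatrix}0&-\mathrm{Id}\\ \mathrm{Id}&0\end{pmatrix}$ with $p\times p$ blocks. A positive hermitian structure on $\mathbb{R}^{2p}$ is a matrix of the form $J=R^{-1}J_0R$ with $R\in SO(2p)$; the set of these is identified with $U(p)\backslash SO(2p)$, where $U(p)$ is the centralizer of $J_0$ in $SO(2p)$. Let $S_0$ be a real symmetric non-negative $2p\times 2p$ matrix. For $J=R^{-1}J_0R$, the matrix $\Sigma=J_0^{-1}(RS_0R^{-1})J_0+RS_0R^{-1}$ is real symmetric and commutes with $J_0$, so it is a hermitian $p\times p$ matrix when $\mathbb{R}^{2p}$ is identified with $\mathbb{C}^p$ through $J_0$. The frequency mapping is $\mathcal{F}(J)=(\nu_1,\dots,\nu_p)$,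 $\nu_1\ge\cdots\ge\nu_p$, the ordered spectrum of this complex hermitian matrix (it depends only on $J$). Equivalently, the eigenvalues of the antisymmetric matrix $S_0J+JS_0$, with multiplicity, are $\pm i\nu_1,\dots,\pm i\nu_p$. A signed permutation is a matrix with exactly one non-zero entry in each row and column, that entry being $\pm1$. With $S_0$ diagonal, an adapted hermitian structure is a positive hermitian structure which can be written $$J_{\rho,P}=P^{-1}\begin{pmatrix}0&-\rho^{-1}\\ \rho&0\end{pmatrix}P,$$ where $\rho\in SO(p)$ and $P\in SO(2p)$ is a signed permutation. *)

theory Defs
  imports
    "Jordan_Normal_Form.Char_Poly"
    "Jordan_Normal_Form.Gauss_Jordan_Elimination"
    Complex_Main
begin

(* Only meaningful for invertible square matrices, see mat_inv_eqI below. *)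
definition mat_inv :: "'a::field mat \<Rightarrow> 'a mat" where
  "mat_inv A = the (mat_inverse A)"

definition special_orthogonal :: "nat \<Rightarrow> real mat set" where
  "special_orthogonal n =
     {R \<in> carrier_mat n n. transpose_mat R * R = 1\<^sub>m n \<and> det R = 1}"

definition J0 :: "nat \<Rightarrow> real mat" where
  "J0 p = four_block_mat (0\<^sub>m p p) (- 1\<^sub>m p) (1\<^sub>m p) (0\<^sub>m p p)"

definition positive_hermitian :: "nat \<Rightarrow> real mat set" where
  "positive_hermitian p =
     {J. \<exists>R \<in> special_orthogonal (2 * p). J = mat_inv R * J0 p * R}"

(* J0 acts on a pair of blocks (x, y) by (-y, x), i.e. as multiplication by i on x + i y.
   A real matrix commuting with J0 has block form ((A, -B), (B, A)) and acts as A + i B. *)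
definition complex_of_commuting :: "nat \<Rightarrow> real mat \<Rightarrow> complex mat" where
  "complex_of_commuting p M = mat p p (\<lambda>(i, j). Complex (M $$ (i, j)) (M $$ (i + p, j)))"

definition Sigma_mat :: "nat \<Rightarrow> real mat \<Rightarrow> real mat \<Rightarrow> real mat" where
  "Sigma_mat p S R =
     mat_inv (J0 p) * (R * S * mat_inv R) * J0 p + R * S * mat_inv R"

(* Eigenvalues with algebraic multiplicity, in decreasing order. Used for hermitian matrices
   only, whose eigenvalues are real, so that Re loses nothing. *)
definition ordered_spectrum :: "complex mat \<Rightarrow> real list" where
  "ordered_spectrum A = rev (sorted_list_of_multiset (image_mset Re (proots (char_poly A))))"

(* The value does not depend on the chosen R, see frequency_map_eq below. *)
definition frequency_map :: "nat \<Rightarrow> real mat \<Rightarrow> real mat \<Rightarrow> real list" where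
  "frequency_map p S J =
     ordered_spectrum (complex_of_commuting p (Sigma_mat p S
       (SOME R. R \<in> special_orthogonal (2 * p) \<and> J = mat_inv R * J0 p * R)))"

definition signed_permutation :: "nat \<Rightarrow> real mat \<Rightarrow> bool" where
  "signed_permutation n P \<longleftrightarrow>
     P \<in> carrier_mat n n \<and>
     (\<forall>i<n. \<exists>!j. j < n \<and> P $$ (i, j) \<noteq> 0) \<and>
     (\<forall>j<n. \<exists>!i. i < n \<and> P $$ (i, j) \<noteq> 0) \<and>
     (\<forall>i<n. \<forall>j<n. P $$ (i, j) \<noteq> 0 \<longrightarrow> P $$ (i, j) = 1 \<or> P $$ (i, j) = - 1)"

definition adapted_matrix :: "nat \<Rightarrow> real mat \<Rightarrow> real mat \<Rightarrow> real mat" where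
  "adapted_matrix p \<rho> P =
     mat_inv P * four_block_mat (0\<^sub>m p p) (- mat_inv \<rho>) \<rho> (0\<^sub>m p p) * P"

definition adapted_hermitian :: "nat \<Rightarrow> real mat set" where
  "adapted_hermitian p =
     {J \<in> positive_hermitian p.
        \<exists>\<rho> \<in> special_orthogonal p. \<exists>P \<in> special_orthogonal (2 * p).
          signed_permutation (2 * p) P \<and> J = adapted_matrix p \<rho> P}"

lemma mat_inv_eqI:
  fixes A B :: "'a::field mat"
  assumes A: "A \<in> carrier_mat n n" and B: "B \<in> carrier_mat n n" and AB: "A * B = 1\<^sub>m n"
  shows "mat_inv A = B"
proof -
  have BA: "B * A = 1\<^sub>m n"
    by (rule mat_mult_left_right_inverse[OF A B AB])
  have "A \<in> Units (ring_mat TYPE('a) n ())"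
    unfolding Units_def ring_mat_simps using A B AB BA by auto
  then obtain C where C: "mat_inverse A = Some C"
    using mat_inverse(1)[OF A, of "()"] by (cases "mat_inverse A") auto
  then have C': "A * C = 1\<^sub>m n" "C \<in> carrier_mat n n"
    using mat_inverse(2)[OF A C] by auto
  have "C = B * A * C" using BA C' by simp
  also have "\<dots> = B" using A B C' by (simp add: assoc_mult_mat[OF B A C'(2)])
  finally show ?thesis unfolding mat_inv_def C by simp
qed

lemma special_orthogonal_inv:
  assumes "R \<in> special_orthogonal n"
  shows "R \<in> carrier_mat n n" "mat_inv R = transpose_mat R" "mat_inv R \<in> carrier_mat n n"
    "mat_inv R * R = 1\<^sub>m n" "R * mat_inv R = 1\<^sub>m n"
proof -
  show R: "R \<in> carrier_mat n n" using assms by (auto simp: special_orthogonal_def)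
  have 1: "transpose_mat R * R = 1\<^sub>m n" using assms by (auto simp: special_orthogonal_def)
  have 2: "R * transpose_mat R = 1\<^sub>m n"
    by (rule mat_mult_left_right_inverse[OF _ R 1]) (use R in auto)
  show 3: "mat_inv R = transpose_mat R" using mat_inv_eqI[OF R _ 2] R by simp
  show "mat_inv R \<in> carrier_mat n n" "mat_inv R * R = 1\<^sub>m n" "R * mat_inv R = 1\<^sub>m n"
    unfolding 3 using R 1 2 by auto
qed

lemma J0_carrier [simp]: "J0 p \<in> carrier_mat (2 * p) (2 * p)"
  unfolding J0_def mult_2 by (rule four_block_carrier_mat) auto

lemma J0_dim [simp]: "dim_row (J0 p) = 2 * p" "dim_col (J0 p) = 2 * p"
  using J0_carrier[of p] by blast+

lemma J0_index:
  assumes "i < 2 * p" "j < 2 * p"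
  shows "J0 p $$ (i, j) = (if j = i + p then - 1 else if i = j + p then 1 else 0)"
  using assms by (auto simp: J0_def)

lemma J0_mult_left:
  assumes M: "M \<in> carrier_mat (2 * p) (2 * p)" and ij: "i < 2 * p" "j < 2 * p"
  shows "(J0 p * M) $$ (i, j) = (if i < p then - M $$ (i + p, j) else M $$ (i - p, j))"
proof -
  have "(J0 p * M) $$ (i, j) = (\<Sum>k\<in>{0..<2 * p}. J0 p $$ (i, k) * M $$ (k, j))"
    using M ij J0_carrier[of p] by (auto simp: scalar_prod_def intro!: sum.cong)
  also have "\<dots> = (\<Sum>k\<in>{0..<2 * p}. if k = (if i < p then i + p else i - p)
                      then (if i < p then - M $$ (i + p, j) else M $$ (i - p, j)) else 0)"
    using ij by (intro sum.cong) (auto simp: J0_index)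
  also have "\<dots> = (if i < p then - M $$ (i + p, j) else M $$ (i - p, j))"
    using ij by (subst sum.delta) auto
  finally show ?thesis .
qed

lemma J0_mult_right:
  assumes M: "M \<in> carrier_mat (2 * p) (2 * p)" and ij: "i < 2 * p" "j < 2 * p"
  shows "(M * J0 p) $$ (i, j) = (if j < p then M $$ (i, j + p) else - M $$ (i, j - p))"
proof -
  have "(M * J0 p) $$ (i, j) = (\<Sum>k\<in>{0..<2 * p}. M $$ (i, k) * J0 p $$ (k, j))"
    using M ij J0_carrier[of p] by (auto simp: scalar_prod_def intro!: sum.cong)
  also have "\<dots> = (\<Sum>k\<in>{0..<2 * p}. if k = (if j < p then j + p else j - p)
                      then (if j < p then M $$ (i, j + p) else - M $$ (i, j - p)) else 0)"
    using ij by (intro sum.cong) (auto simp: J0_index)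
  also have "\<dots> = (if j < p then M $$ (i, j + p) else - M $$ (i, j - p))"
    using ij by (subst sum.delta) auto
  finally show ?thesis .
qed

lemma J0_square: "J0 p * J0 p = - 1\<^sub>m (2 * p)"
proof (rule eq_matI)
  fix i j assume "i < dim_row (- 1\<^sub>m (2 * p) :: real mat)" "j < dim_col (- 1\<^sub>m (2 * p) :: real mat)"
  then have ij: "i < 2 * p" "j < 2 * p" by auto
  then show "(J0 p * J0 p) $$ (i, j) = (- 1\<^sub>m (2 * p)) $$ (i, j)"
    by (subst J0_mult_left) (auto simp: J0_index)
qed (use J0_carrier[of p] in auto)

lemma mat_inv_J0: "mat_inv (J0 p) = - J0 p"
proof (rule mat_inv_eqI)
  show "J0 p * - J0 p = 1\<^sub>m (2 * p)"
    using J0_square[of p] by (metis J0_carrier uminus_mult_right_mat carrier_matD uminus_uminus_mat)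
qed auto

lemma complex_of_commuting_mult:
  assumes M: "M \<in> carrier_mat (2 * p) (2 * p)" and N: "N \<in> carrier_mat (2 * p) (2 * p)"
    and com: "J0 p * M = M * J0 p"
  shows "complex_of_commuting p (M * N) = complex_of_commuting p M * complex_of_commuting p N"
proof (rule eq_matI)
  fix i j assume "i < dim_row (complex_of_commuting p M * complex_of_commuting p N)"
    "j < dim_col (complex_of_commuting p M * complex_of_commuting p N)"
  then have ij: "i < p" "j < p" by (auto simp: complex_of_commuting_def)
  have b1: "M $$ (i, k + p) = - M $$ (i + p, k)" if "k < p" for k
    using arg_cong[OF com, of "\<lambda>X. X $$ (i, k)"] that ij M by (simp add: J0_mult_left J0_mult_right del: index_mult_mat)
  have b2: "M $$ (i + p, k + p) = M $$ (i, k)" if "k < p" for k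
    using arg_cong[OF com, of "\<lambda>X. X $$ (i + p, k)"] that ij M by (simp add: J0_mult_left J0_mult_right del: index_mult_mat)
  have e: "(M * N) $$ (r, j) = (\<Sum>k\<in>{0..<p}. M $$ (r, k) * N $$ (k, j))
             + (\<Sum>k\<in>{0..<p}. M $$ (r, k + p) * N $$ (k + p, j))" if "r < 2 * p" for r
  proof -
    have "(M * N) $$ (r, j) = (\<Sum>k\<in>{0..<p + p}. M $$ (r, k) * N $$ (k, j))"
      using M N that ij by (auto simp: scalar_prod_def intro!: sum.cong)
    also have "\<dots> = (\<Sum>k\<in>{0..<p}. M $$ (r, k) * N $$ (k, j))
             + (\<Sum>k\<in>{p..<p + p}. M $$ (r, k) * N $$ (k, j))"
      by (subst sum.atLeastLessThan_concat) auto
    also have "(\<Sum>k\<in>{p..<p + p}. M $$ (r, k) * N $$ (k, j))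
             = (\<Sum>k\<in>{0..<p}. M $$ (r, k + p) * N $$ (k + p, j))"
      using sum.shift_bounds_nat_ivl[of "\<lambda>k. M $$ (r, k) * N $$ (k, j)" 0 p p] by simp
    finally show ?thesis .
  qed
  have "complex_of_commuting p (M * N) $$ (i, j)
      = Complex ((M * N) $$ (i, j)) ((M * N) $$ (i + p, j))"
    using ij by (simp add: complex_of_commuting_def)
  also have "\<dots> = (\<Sum>k\<in>{0..<p}. Complex (M $$ (i, k)) (M $$ (i + p, k))
                                * Complex (N $$ (k, j)) (N $$ (k + p, j)))"
    using ij by (simp add: e complex_eq_iff b1 b2 sum.distrib sum_subtractf sum_negf add.commute del: index_mult_mat)
  also have "\<dots> = (complex_of_commuting p M * complex_of_commuting p N) $$ (i, j)"
    using ij by (auto simp: complex_of_commuting_def scalar_prod_def intro!: sum.cong)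
  finally show "complex_of_commuting p (M * N) $$ (i, j)
      = (complex_of_commuting p M * complex_of_commuting p N) $$ (i, j)" .
qed (auto simp: complex_of_commuting_def)

lemma complex_of_commuting_one: "complex_of_commuting p (1\<^sub>m (2 * p)) = 1\<^sub>m p"
  by (rule eq_matI) (auto simp: complex_of_commuting_def complex_eq_iff)

lemma Sigma_mat_commutes:
  assumes X: "R * S * mat_inv R \<in> carrier_mat (2 * p) (2 * p)"
  shows "Sigma_mat p S R \<in> carrier_mat (2 * p) (2 * p)"
    "J0 p * Sigma_mat p S R = Sigma_mat p S R * J0 p"
proof -
  define X where "X = R * S * mat_inv R"
  have X: "X \<in> carrier_mat (2 * p) (2 * p)" using assms by (simp add: X_def)
  have XJ: "X * J0 p \<in> carrier_mat (2 * p) (2 * p)" using X by (rule mult_carrier_mat) simp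
  have Sig: "Sigma_mat p S R = - (J0 p * (X * J0 p)) + X"
  proof -
    have "- J0 p * X * J0 p = - (J0 p * (X * J0 p))"
      using X uminus_mult_left_mat[of "J0 p" X] uminus_mult_left_mat[of "J0 p * X" "J0 p"]
      by (simp add: assoc_mult_mat[OF J0_carrier X J0_carrier])
    then show ?thesis unfolding Sigma_mat_def mat_inv_J0 X_def by simp
  qed
  show c: "Sigma_mat p S R \<in> carrier_mat (2 * p) (2 * p)"
    unfolding Sig using X by auto
  have ent: "Sigma_mat p S R $$ (i, j) = X $$ (i, j) - (J0 p * (X * J0 p)) $$ (i, j)"
    if "i < 2 * p" "j < 2 * p" for i j
    unfolding Sig using that X by (simp del: index_mult_mat(1))
  show "J0 p * Sigma_mat p S R = Sigma_mat p S R * J0 p"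
  proof (rule eq_matI)
    fix i j assume "i < dim_row (Sigma_mat p S R * J0 p)" "j < dim_col (Sigma_mat p S R * J0 p)"
    then have ij: "i < 2 * p" "j < 2 * p" using c by auto
    show "(J0 p * Sigma_mat p S R) $$ (i, j) = (Sigma_mat p S R * J0 p) $$ (i, j)"
      using ij
      by (cases "i < p"; cases "j < p")
        (simp_all add: J0_mult_left[OF c] J0_mult_right[OF c] ent not_less less_diff_conv2
          J0_mult_left[OF XJ] J0_mult_right[OF X] del: index_mult_mat(1))
  qed (use c in auto)
qed

lemma ordered_spectrum_indep:
  assumes S: "S \<in> carrier_mat (2 * p) (2 * p)"
    and R: "R \<in> special_orthogonal (2 * p)" and Q: "Q \<in> special_orthogonal (2 * p)"
    and eq: "mat_inv R * J0 p * R = mat_inv Q * J0 p * Q"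
  shows "ordered_spectrum (complex_of_commuting p (Sigma_mat p S R)) =
         ordered_spectrum (complex_of_commuting p (Sigma_mat p S Q))"
proof -
  let ?n = "2 * p"
  note [simp] = assoc_mult_mat[of _ ?n ?n _ ?n _ ?n] mult_carrier_mat[of _ ?n ?n _ ?n]
    and [simp del] = index_mult_mat(1)
  note r = special_orthogonal_inv(1,3,4,5)[OF R] and q = special_orthogonal_inv(1,3,4,5)[OF Q]
  note J = J0_carrier[of p]
  have iJ: "mat_inv (J0 p) \<in> carrier_mat ?n ?n" by (simp add: mat_inv_J0)
  have cancel: "A * (B * Z) = Z" if "A * B = 1\<^sub>m ?n" "A \<in> carrier_mat ?n ?n"
    "B \<in> carrier_mat ?n ?n" "Z \<in> carrier_mat ?n ?n" for A B Z :: "real mat"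
    using that by (metis assoc_mult_mat left_mult_one_mat)
  define U where "U = Q * mat_inv R"
  define V where "V = R * mat_inv Q"
  have U: "U \<in> carrier_mat ?n ?n" and V: "V \<in> carrier_mat ?n ?n"
    using r q by (auto simp: U_def V_def)
  have UV: "U * V = 1\<^sub>m ?n" and VU: "V * U = 1\<^sub>m ?n"
    using r q by (auto simp: U_def V_def cancel)
  have "J0 p * U = Q * (mat_inv Q * J0 p * Q) * mat_inv R"
    using q r by (simp add: U_def cancel)
  also have "\<dots> = U * J0 p"
    unfolding eq[symmetric] using q r by (simp add: U_def)
  finally have JU: "J0 p * U = U * J0 p" .
  have JV: "J0 p * V = V * J0 p"
  proof -
    have "J0 p * V = V * (U * J0 p) * V" using U V VU by (simp add: cancel)
    also have "\<dots> = V * J0 p" unfolding JU[symmetric] using U V UV by simp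
    finally show ?thesis .
  qed
  define X where "X = R * S * mat_inv R"
  define Y where "Y = Q * S * mat_inv Q"
  have X: "X \<in> carrier_mat ?n ?n" and Y: "Y \<in> carrier_mat ?n ?n"
    using r q S by (auto simp: X_def Y_def)
  have YX: "Y = U * X * V"
    using r q S by (simp add: X_def Y_def U_def V_def cancel)
  have JX: "mat_inv (J0 p) * X * J0 p \<in> carrier_mat ?n ?n"
    using iJ X J by (intro mult_carrier_mat[of _ _ ?n])
  have iJU: "mat_inv (J0 p) * U = U * mat_inv (J0 p)"
    unfolding mat_inv_J0 using U JU by (simp add: uminus_mult_left_mat uminus_mult_right_mat)
  have Sig: "Sigma_mat p S Q = U * Sigma_mat p S R * V"
  proof -
    have "mat_inv (J0 p) * Y * J0 p = mat_inv (J0 p) * U * X * (V * J0 p)"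
      using YX U V X iJ by simp
    also have "\<dots> = U * (mat_inv (J0 p) * X * J0 p) * V"
      unfolding iJU JV[symmetric] using U V X iJ by simp
    finally have 1: "mat_inv (J0 p) * Y * J0 p = U * (mat_inv (J0 p) * X * J0 p) * V" .
    have "U * (mat_inv (J0 p) * X * J0 p + X) * V
        = U * (mat_inv (J0 p) * X * J0 p) * V + U * X * V"
      using mult_add_distrib_mat[OF U JX X]
        add_mult_distrib_mat[OF mult_carrier_mat[OF U JX] mult_carrier_mat[OF U X] V] by (simp only:)
    then show ?thesis
      unfolding Sigma_mat_def X_def[symmetric] Y_def[symmetric] 1 unfolding YX by (simp only:)
  qed
  note T = Sigma_mat_commutes[OF X[unfolded X_def]]
  let ?C = "complex_of_commuting p"
  have [simp]: "?C M \<in> carrier_mat p p" for M by (simp add: complex_of_commuting_def)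
  have "?C (Sigma_mat p S Q) = ?C (U * (Sigma_mat p S R * V))"
    unfolding Sig using U V T(1) by simp
  also have "\<dots> = ?C U * ?C (Sigma_mat p S R) * ?C V"
    using U V T JU JV
    by (simp add: complex_of_commuting_mult assoc_mult_mat[of _ p p _ p _ p])
  finally have "?C (Sigma_mat p S Q) = ?C U * ?C (Sigma_mat p S R) * ?C V" .
  moreover have "?C U * ?C V = 1\<^sub>m p" "?C V * ?C U = 1\<^sub>m p"
    using complex_of_commuting_mult[OF U V JU] complex_of_commuting_mult[OF V U JV]
    by (simp_all add: UV VU complex_of_commuting_one)
  ultimately have "similar_mat (?C (Sigma_mat p S Q)) (?C (Sigma_mat p S R))"
    by (intro similar_matI[of _ _ "?C U" "?C V" p]) (auto intro!: mult_carrier_mat[of _ p p])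
  from char_poly_similar[OF this] show ?thesis by (simp add: ordered_spectrum_def)
qed

lemma frequency_map_eq:
  assumes S: "S \<in> carrier_mat (2 * p) (2 * p)" and R: "R \<in> special_orthogonal (2 * p)"
  shows "frequency_map p S (mat_inv R * J0 p * R) =
         ordered_spectrum (complex_of_commuting p (Sigma_mat p S R))"
proof -
  let ?P = "\<lambda>Q. Q \<in> special_orthogonal (2 * p) \<and> mat_inv R * J0 p * R = mat_inv Q * J0 p * Q"
  have "?P (SOME Q. ?P Q)" by (rule someI[of ?P R]) (use R in simp)
  then have Q: "(SOME Q. ?P Q) \<in> special_orthogonal (2 * p)"
    "mat_inv R * J0 p * R = mat_inv (SOME Q. ?P Q) * J0 p * (SOME Q. ?P Q)"
    by (rule conjunct1, rule conjunct2)
  show ?thesis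
    unfolding frequency_map_def by (rule ordered_spectrum_indep[OF S R Q, symmetric])
qed

end

theory Submission
  imports Defs
begin

text \<open>
  In real dimension four the hermitian matrix whose spectrum is the frequency pair is a
  $2\times 2$ complex matrix, so the pair is determined by the trace $\nu_1+\nu_2$ and the determinant
  $\nu_1\nu_2$. The trace is the trace of $S_0$, the same for every $J$. Everything
  therefore rests on the determinant, and the point is that it is an affine function of the squared
  entries of $J$: writing $a = J_{01}^2$, $b = J_{02}^2$, $c = J_{03}^2$, it equals
  \[ a\,(\sigma_0+\sigma_1)(\sigma_2+\sigma_3) + b\,(\sigma_0+\sigma_2)(\sigma_1+\sigma_3)
     + c\,(\sigma_0+\sigma_3)(\sigma_1+\sigma_2), \qquad a+b+c=1 \]
  (\<open>frequency_map_4\<close>). So $\nu_1\nu_2$ is a convex combination of three numbers, one for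
  each way of splitting the four coordinates into two pairs.

  To see the formula, let $z_k \in \mathbb{C}^2$ be the $k$-th column of $R$. The hermitian matrix
  is $\sum_k \sigma_k z_k z_k^*$, hence by Cauchy--Binet its determinant is
  $\sum_{k<l}\sigma_k\sigma_l\,|\det(z_k,z_l)|^2$, and
  $|\det(z_k,z_l)|^2 = |z_k|^2|z_l|^2-|\langle z_k,z_l\rangle|^2 = 1 - J_{kl}^2$,
  because the columns of $R$ are orthonormal and the imaginary part of the hermitian product is the
  entry of $J$ up to sign. As $J$ is orthogonal and antisymmetric, its squared entries at
  complementary pairs of indices agree, and $\sum_{k<l}\sigma_k\sigma_l(1-J_{kl}^2)$ turns into
  the displayed expression.

  A convex combination of three real numbers already lies between two of them, so it is a convex
  combination of just two. The structures $J_{\rho,P}$ realise exactly such combinations: when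
  $\rho$ is the rotation by an angle $\theta$, the weights are $0,\cos^2\theta,\sin^2\theta$ in an
  order chosen by a permutation of the coordinates
  (\<open>adapted_hermitian_with_two_weights\<close>). Cyclic permutations of three coordinates reach
  every pair of weights, and being even they lie in $SO(4)$ without any change of sign.
\<close>

section \<open>Characteristic polynomials of two-by-two matrices\<close>

lemma sum_atLeast0LessThan_4: "(\<Sum>k\<in>{0..<4::nat}. f k) = f 0 + f 1 + f 2 + (f 3 :: 'a::comm_monoid_add)"
  by (simp add: eval_nat_numeral add.assoc)

lemma det_2x2:
  fixes A :: "'a::comm_ring_1 mat"
  assumes A: "A \<in> carrier_mat 2 2"
  shows "det A = A $$ (0, 0) * A $$ (1, 1) - A $$ (0, 1) * A $$ (1, 0)"
  using A by (subst laplace_expansion_row[OF A, of 0])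
    (auto simp: cofactor_def mat_delete_def det_single numeral_2_eq_2)

lemma char_poly_2x2:
  fixes A :: "'a::field mat"
  assumes A: "A \<in> carrier_mat 2 2"
  shows "char_poly A = [: A $$ (0, 0) * A $$ (1, 1) - A $$ (0, 1) * A $$ (1, 0),
                          - (A $$ (0, 0) + A $$ (1, 1)), 1 :]"
  unfolding char_poly_def using A
  by (subst det_2x2) (auto simp: char_poly_matrix_def algebra_simps)

section \<open>The determinant as a function of the weights\<close>

text \<open>
  The product $\nu_1\nu_2$, where \<open>a\<close>, \<open>b\<close>, \<open>c\<close> weight the splittings
  $01|23$, $02|13$ and $03|12$ of the four coordinates.
\<close>
definition pairing_value :: "(nat \<Rightarrow> real) \<Rightarrow> real \<Rightarrow> real \<Rightarrow> real \<Rightarrow> real" where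
  "pairing_value \<sigma> a b c =
     a * ((\<sigma> 0 + \<sigma> 1) * (\<sigma> 2 + \<sigma> 3)) + b * ((\<sigma> 0 + \<sigma> 2) * (\<sigma> 1 + \<sigma> 3))
     + c * ((\<sigma> 0 + \<sigma> 3) * (\<sigma> 1 + \<sigma> 2))"

text \<open>
  The left-hand side is the determinant of $\sum_k \sigma_k z_k z_k^*$ with
  $z_k = (r_{0k}+i r_{2k},\, r_{1k}+i r_{3k})$, and \<open>d k l\<close> is
  $|\det(z_k,z_l)|^2$: this is the Cauchy--Binet formula for the product of the $2\times 4$
  matrix of columns $\sigma_k z_k$ with the adjoint of the one of columns $z_k$, written as a
  polynomial identity in real coordinates.
\<close>
lemma Cauchy_Binet_rank_two:
  fixes r :: "nat \<Rightarrow> nat \<Rightarrow> real" and \<sigma> :: "nat \<Rightarrow> real"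
  defines "x \<equiv> \<lambda>i j. \<sigma> 0 * r i 0 * r j 0 + \<sigma> 1 * r i 1 * r j 1 + \<sigma> 2 * r i 2 * r j 2 + \<sigma> 3 * r i 3 * r j 3"
    and "d \<equiv> \<lambda>k l. (r 0 k * r 1 l - r 2 k * r 3 l - r 0 l * r 1 k + r 2 l * r 3 k)\<^sup>2
                   + (r 0 k * r 3 l + r 2 k * r 1 l - r 0 l * r 3 k - r 2 l * r 1 k)\<^sup>2"
  shows "(x 0 0 + x 2 2) * (x 1 1 + x 3 3) - (x 0 1 + x 2 3)\<^sup>2 - (x 2 1 - x 0 3)\<^sup>2
       = \<sigma> 0 * \<sigma> 1 * d 0 1 + \<sigma> 0 * \<sigma> 2 * d 0 2 + \<sigma> 0 * \<sigma> 3 * d 0 3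
         + \<sigma> 1 * \<sigma> 2 * d 1 2 + \<sigma> 1 * \<sigma> 3 * d 1 3 + \<sigma> 2 * \<sigma> 3 * d 2 3"
  unfolding x_def d_def by (simp add: power2_eq_square algebra_simps)

text \<open>
  Lagrange's identity $|\det(z,z')|^2 = |z|^2|z'|^2-|\langle z,z'\rangle|^2$ for
  $z=(a+ic,\,b+id)$ and $z'=(a'+ic',\,b'+id')$; the last two squares are those of the real and
  imaginary parts of $\langle z,z'\rangle$, that is, of the euclidean product and of the symplectic
  form.
\<close>
lemma Lagrange_identity_complex_plane:
  fixes a b c d a' b' c' d' :: real
  shows "(a * b' - c * d' - a' * b + c' * d)\<^sup>2 + (a * d' + c * b' - a' * d - c' * b)\<^sup>2
    = (a\<^sup>2 + b\<^sup>2 + c\<^sup>2 + d\<^sup>2) * (a'\<^sup>2 + b'\<^sup>2 + c'\<^sup>2 + d'\<^sup>2)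
      - (a * a' + b * b' + c * c' + d * d')\<^sup>2 - (c * a' + d * b' - a * c' - b * d')\<^sup>2"
  by (simp add: power2_eq_square algebra_simps)

section \<open>Entries of positive hermitian structures\<close>

lemma positive_hermitianE:
  assumes "J \<in> positive_hermitian p"
  shows "J \<in> carrier_mat (2 * p) (2 * p)" "J\<^sup>T = - J" "J * J = - 1\<^sub>m (2 * p)"
proof -
  let ?n = "2 * p"
  obtain R where R: "R \<in> special_orthogonal ?n" and J: "J = mat_inv R * J0 p * R"
    using assms by (auto simp: positive_hermitian_def)
  note r = special_orthogonal_inv[OF R]
  note [simp] = assoc_mult_mat[of _ ?n ?n _ ?n _ ?n] mult_carrier_mat[of _ ?n ?n _ ?n]
    and [simp del] = index_mult_mat(1)
  show "J \<in> carrier_mat ?n ?n" using r by (simp add: J)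
  have tJ0: "(J0 p)\<^sup>T = - J0 p"
    by (rule eq_matI) (auto simp: J0_index)
  have "J\<^sup>T = R\<^sup>T * ((J0 p)\<^sup>T * R)"
    unfolding J r(2) using r(1) by (simp add: transpose_mult[of _ ?n ?n _ ?n])
  also have "\<dots> = - J"
    unfolding tJ0 J r(2) using r(1) by simp
  finally show "J\<^sup>T = - J" .
  have "J * J = mat_inv R * (J0 p * ((R * mat_inv R) * (J0 p * R)))"
    unfolding J using r(1,3) by simp
  also have "\<dots> = mat_inv R * ((J0 p * J0 p) * R)"
    unfolding r(5) using r(1,3) by simp
  also have "\<dots> = - 1\<^sub>m ?n"
    unfolding J0_square using r by simp
  finally show "J * J = - 1\<^sub>m ?n" .
qed

text \<open>
  Antisymmetry and $J^2=-1$ make the squared entries of each row sum to $1$. The four row sums are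
  linear equations in the six squares above the diagonal; adding rows $0$ and $1$ and
  subtracting rows $2$ and $3$ leaves $2J_{01}^2 = 2J_{23}^2$, and likewise for the other
  two complementary pairs.
\<close>
lemma positive_hermitian_4_entries:
  assumes "J \<in> positive_hermitian 2"
  shows "(J $$ (0, 1))\<^sup>2 + (J $$ (0, 2))\<^sup>2 + (J $$ (0, 3))\<^sup>2 = 1"
    "(J $$ (2, 3))\<^sup>2 = (J $$ (0, 1))\<^sup>2"
    "(J $$ (1, 3))\<^sup>2 = (J $$ (0, 2))\<^sup>2"
    "(J $$ (1, 2))\<^sup>2 = (J $$ (0, 3))\<^sup>2"
proof -
  have J: "J \<in> carrier_mat 4 4" "J\<^sup>T = - J" "J * J = - 1\<^sub>m 4"
    using positive_hermitianE[OF assms] by simp_all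
  have skew: "J $$ (j, i) = - J $$ (i, j)" if "i < 4" "j < 4" for i j
    using arg_cong[OF J(2), of "\<lambda>X. X $$ (i, j)"] that J(1) by simp
  have row: "(\<Sum>j\<in>{0..<4}. (J $$ (i, j))\<^sup>2) = 1" if "i < 4" for i
  proof -
    have "(J * J) $$ (i, i) = (\<Sum>j\<in>{0..<4}. J $$ (i, j) * J $$ (j, i))"
      using J(1) that by (simp add: scalar_prod_def)
    also have "\<dots> = - (\<Sum>j\<in>{0..<4}. (J $$ (i, j))\<^sup>2)"
      using that by (auto simp: skew[of i] power2_eq_square sum_negf[symmetric] intro!: sum.cong)
    finally show ?thesis using J(3) that by simp
  qed
  have diag: "J $$ (i, i) = 0" if "i < 4" for i using skew[of i i] that by simp
  have low: "J $$ (1, 0) = - J $$ (0, 1)" "J $$ (2, 0) = - J $$ (0, 2)" "J $$ (3, 0) = - J $$ (0, 3)"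
    "J $$ (2, 1) = - J $$ (1, 2)" "J $$ (3, 1) = - J $$ (1, 3)" "J $$ (3, 2) = - J $$ (2, 3)"
    by (rule skew; simp)+
  note rows = row[of 0] row[of 1] row[of 2] row[of 3]
  show "(J $$ (0, 1))\<^sup>2 + (J $$ (0, 2))\<^sup>2 + (J $$ (0, 3))\<^sup>2 = 1"
    "(J $$ (2, 3))\<^sup>2 = (J $$ (0, 1))\<^sup>2"
    "(J $$ (1, 3))\<^sup>2 = (J $$ (0, 2))\<^sup>2"
    "(J $$ (1, 2))\<^sup>2 = (J $$ (0, 3))\<^sup>2"
    using rows unfolding sum_atLeast0LessThan_4 by (simp_all add: diag low del: One_nat_def)
qed

text \<open>
  The characteristic polynomial appears here with explicit coefficients, so that equality of the
  determinants is all that is needed for equality of frequencies.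
\<close>
lemma frequency_map_4:
  assumes J: "J \<in> positive_hermitian 2"
  shows "frequency_map 2 (mat_diag 4 \<sigma>) J =
    rev (sorted_list_of_multiset (image_mset Re (proots
      [: complex_of_real (pairing_value \<sigma> ((J $$ (0, 1))\<^sup>2) ((J $$ (0, 2))\<^sup>2) ((J $$ (0, 3))\<^sup>2)),
         - complex_of_real (\<sigma> 0 + \<sigma> 1 + \<sigma> 2 + \<sigma> 3), 1 :])))"
proof -
  obtain R where R: "R \<in> special_orthogonal (2 * 2)" and JR: "J = mat_inv R * J0 2 * R"
    using J by (auto simp: positive_hermitian_def)
  define r where "r = (\<lambda>i k. R $$ (i, k))"
  have Rc: "R \<in> carrier_mat 4 4" and inv: "mat_inv R = R\<^sup>T" and RtR: "R\<^sup>T * R = 1\<^sub>m 4"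
    using special_orthogonal_inv[OF R] by simp_all
  have orth: "r 0 k * r 0 l + r 1 k * r 1 l + r 2 k * r 2 l + r 3 k * r 3 l = (if k = l then 1 else 0)"
    if "k < 4" "l < 4" for k l
    using arg_cong[OF RtR, of "\<lambda>X. X $$ (k, l)"] that Rc
    by (simp add: scalar_prod_def sum_atLeast0LessThan_4 r_def)
  (* J k l is, up to sign, the imaginary part of the hermitian product of columns k and l of R. *)
  have Jkl: "J $$ (k, l) = r 2 k * r 0 l + r 3 k * r 1 l - r 0 k * r 2 l - r 1 k * r 3 l"
    if "k < 4" "l < 4" for k l
  proof -
    have JRc: "J0 2 * R \<in> carrier_mat 4 4" using J0_carrier[of 2] Rc by auto
    have "J = R\<^sup>T * (J0 2 * R)"
      unfolding JR inv using assoc_mult_mat[of "R\<^sup>T" 4 4 "J0 2" 4 R 4] J0_carrier[of 2] Rc by simp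
    then have "J $$ (k, l) = (\<Sum>i\<in>{0..<4}. R $$ (i, k) * (J0 2 * R) $$ (i, l))"
      using JRc Rc that by (simp add: scalar_prod_def del: index_mult_mat(1) assoc_mult_mat)
        (simp add: index_mult_mat(1) scalar_prod_def)
    then show ?thesis
      using Rc that by (simp add: sum_atLeast0LessThan_4 J0_mult_left r_def del: index_mult_mat(1))
        (simp add: numeral_2_eq_2 numeral_3_eq_3)
  qed
  (* x i j are the entries of R S R^T; in the block convention of J0, the complex coordinates of a
     vector v are v 0 + i v 2 and v 1 + i v 3. *)
  define x where "x = (\<lambda>i j. \<sigma> 0 * r i 0 * r j 0 + \<sigma> 1 * r i 1 * r j 1 + \<sigma> 2 * r i 2 * r j 2
                           + \<sigma> 3 * r i 3 * r j 3)"
  define X where "X = R * mat_diag 4 \<sigma> * mat_inv R"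
  have Xc: "X \<in> carrier_mat 4 4" using Rc by (auto simp: X_def inv intro!: mult_carrier_mat)
  have Xij: "X $$ (i, j) = x i j" if "i < 4" "j < 4" for i j
    using Rc that unfolding X_def inv
    by (simp add: mat_diag_mult_right[OF Rc] scalar_prod_def sum_atLeast0LessThan_4 x_def r_def algebra_simps)
  define C where "C = complex_of_commuting 2 (Sigma_mat 2 (mat_diag 4 \<sigma>) R)"
  have Cc: "C \<in> carrier_mat 2 2" by (simp add: C_def complex_of_commuting_def)
  have Sig: "Sigma_mat 2 (mat_diag 4 \<sigma>) R $$ (i, j) = x i j - (J0 2 * (X * J0 2)) $$ (i, j)"
    if "i < 4" "j < 4" for i j
  proof -
    have c: "J0 2 \<in> carrier_mat 4 4" using J0_carrier[of 2] by simp
    have "Sigma_mat 2 (mat_diag 4 \<sigma>) R = - (J0 2 * (X * J0 2)) + X"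
      unfolding Sigma_mat_def mat_inv_J0 X_def[symmetric]
      using c Xc assoc_mult_mat[OF c Xc c] uminus_mult_left_mat[of "J0 2" X]
        uminus_mult_left_mat[of "J0 2 * X" "J0 2"] by simp
    then show ?thesis using that Xc c Xij[OF that] by (simp del: index_mult_mat(1))
  qed
  have XJ: "X * J0 2 \<in> carrier_mat (2 * 2) (2 * 2)" and Xc': "X \<in> carrier_mat (2 * 2) (2 * 2)"
    using Xc J0_carrier[of 2] by (auto intro: mult_carrier_mat)
  have Cij: "C $$ (i, j) = Complex (x i j + x (i + 2) (j + 2)) (x (i + 2) j - x i (j + 2))"
    if "i < 2" "j < 2" for i j
    using that unfolding C_def complex_of_commuting_def
    by (simp add: Sig J0_mult_left[OF XJ] J0_mult_right[OF Xc'] Xij del: index_mult_mat(1))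
  have sym: "x i j = x j i" for i j by (simp add: x_def mult.commute mult.left_commute)
  (* Symmetry of x makes C hermitian. *)
  have C: "C $$ (0, 0) = complex_of_real (x 0 0 + x 2 2)" "C $$ (1, 1) = complex_of_real (x 1 1 + x 3 3)"
    "C $$ (0, 1) = Complex (x 0 1 + x 2 3) (x 2 1 - x 0 3)"
    "C $$ (1, 0) = Complex (x 0 1 + x 2 3) (- (x 2 1 - x 0 3))"
    using Cij[of 0 0] Cij[of 1 1] Cij[of 0 1] Cij[of 1 0]
      sym[of 0 2] sym[of 1 3] sym[of 3 0] sym[of 1 2] sym[of 1 0] sym[of 3 2]
    by (simp_all add: complex_eq_iff numeral_2_eq_2 numeral_3_eq_3)
  have tr: "C $$ (0, 0) + C $$ (1, 1) = complex_of_real (\<sigma> 0 + \<sigma> 1 + \<sigma> 2 + \<sigma> 3)"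
  proof -
    (* The trace is invariant under conjugation because each column of R is a unit vector. *)
    have "x 0 0 + x 2 2 + (x 1 1 + x 3 3) = (\<Sum>k\<in>{0..<4}. \<sigma> k * (r 0 k * r 0 k + r 1 k * r 1 k + r 2 k * r 2 k + r 3 k * r 3 k))"
      by (simp add: x_def sum_atLeast0LessThan_4 algebra_simps)
    also have "\<dots> = \<sigma> 0 + \<sigma> 1 + \<sigma> 2 + \<sigma> 3" by (simp add: orth sum_atLeast0LessThan_4 del: One_nat_def)
    finally show ?thesis
      unfolding C by (metis of_real_add)
  qed
  define d where "d = (\<lambda>k l. (r 0 k * r 1 l - r 2 k * r 3 l - r 0 l * r 1 k + r 2 l * r 3 k)\<^sup>2
                   + (r 0 k * r 3 l + r 2 k * r 1 l - r 0 l * r 3 k - r 2 l * r 1 k)\<^sup>2)"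
  (* Orthonormal columns: the norms in Lagrange's identity are 1 and the real part vanishes. *)
  have d: "d k l = 1 - (J $$ (k, l))\<^sup>2" if "k < 4" "l < 4" "k \<noteq> l" for k l
    unfolding d_def Lagrange_identity_complex_plane Jkl[OF that(1,2)]
    using orth[OF that(1,1)] orth[OF that(2,2)] orth[OF that(1,2)] that
    by (simp add: power2_eq_square)
  note ent = positive_hermitian_4_entries[OF J]
  (* With c eliminated through a + b + c = 1, the comparison of the two forms of the determinant
     becomes a polynomial identity. *)
  define a b c where "a = (J $$ (0, 1))\<^sup>2" and "b = (J $$ (0, 2))\<^sup>2" and "c = (J $$ (0, 3))\<^sup>2"
  have sum1: "c = 1 - a - b" using ent(1) by (simp add: a_def b_def c_def)
  have "C $$ (0, 0) * C $$ (1, 1) - C $$ (0, 1) * C $$ (1, 0)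
      = complex_of_real ((x 0 0 + x 2 2) * (x 1 1 + x 3 3) - (x 0 1 + x 2 3)\<^sup>2 - (x 2 1 - x 0 3)\<^sup>2)"
    unfolding C by (simp add: complex_eq_iff power2_eq_square algebra_simps)
  also have "(x 0 0 + x 2 2) * (x 1 1 + x 3 3) - (x 0 1 + x 2 3)\<^sup>2 - (x 2 1 - x 0 3)\<^sup>2
      = \<sigma> 0 * \<sigma> 1 * d 0 1 + \<sigma> 0 * \<sigma> 2 * d 0 2 + \<sigma> 0 * \<sigma> 3 * d 0 3
         + \<sigma> 1 * \<sigma> 2 * d 1 2 + \<sigma> 1 * \<sigma> 3 * d 1 3 + \<sigma> 2 * \<sigma> 3 * d 2 3"
    unfolding x_def d_def by (rule Cauchy_Binet_rank_two)
  also have "\<dots> = pairing_value \<sigma> a b c"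
    using ent(2-4)[folded a_def b_def c_def]
    by (simp add: d a_def[symmetric] b_def[symmetric] c_def[symmetric] del: One_nat_def)
      (simp add: sum1 pairing_value_def algebra_simps)
  finally have det: "C $$ (0, 0) * C $$ (1, 1) - C $$ (0, 1) * C $$ (1, 0)
      = complex_of_real (pairing_value \<sigma> a b c)" .
  have "frequency_map 2 (mat_diag 4 \<sigma>) J = ordered_spectrum C"
    unfolding JR C_def by (rule frequency_map_eq[OF _ R]) simp
  then show ?thesis
    unfolding ordered_spectrum_def char_poly_2x2[OF Cc] det tr a_def b_def c_def .
qed

section \<open>Adapted hermitian structures\<close>

lemma special_orthogonal_mult:
  assumes "A \<in> special_orthogonal n" "B \<in> special_orthogonal n"
  shows "A * B \<in> special_orthogonal n"
proof -
  note a = special_orthogonal_inv[OF assms(1)] and b = special_orthogonal_inv[OF assms(2)]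
  have "(A * B)\<^sup>T * (A * B) = B\<^sup>T * ((A\<^sup>T * A) * B)"
    using a(1) b(1) by (simp add: transpose_mult[of _ n n _ n] assoc_mult_mat[of _ n n _ n _ n] mult_carrier_mat[of _ n n _ n])
  also have "\<dots> = 1\<^sub>m n" using a(1,2,4) b(1,2,4) by simp
  finally show ?thesis
    using assms a(1) b(1) by (auto simp: special_orthogonal_def det_mult)
qed

text \<open>
  With $Q=\mathrm{diag}(\rho,1)\in SO(2p)$ the block matrix in the definition of
  $J_{\rho,P}$ is $Q^{-1}J_0Q$, hence $J_{\rho,P} = (QP)^{-1}J_0(QP)$.
\<close>
lemma adapted_matrix_positive_hermitian:
  assumes \<rho>: "\<rho> \<in> special_orthogonal p" and P: "P \<in> special_orthogonal (2 * p)"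
  shows "adapted_matrix p \<rho> P \<in> positive_hermitian p"
proof -
  let ?n = "2 * p"
  note r = special_orthogonal_inv[OF \<rho>] and q = special_orthogonal_inv[OF P]
  define Q where "Q = four_block_mat \<rho> (0\<^sub>m p p) (0\<^sub>m p p) (1\<^sub>m p)"
  have Qt: "Q\<^sup>T = four_block_mat (\<rho>\<^sup>T) (0\<^sub>m p p) (0\<^sub>m p p) (1\<^sub>m p)"
    unfolding Q_def using r(1) by (subst transpose_four_block_mat[of _ p p _ p _ p]) auto
  have Qc: "Q \<in> carrier_mat ?n ?n" unfolding Q_def mult_2 using r(1) by (intro four_block_carrier_mat) auto
  have Q: "Q \<in> special_orthogonal ?n"
  proof -
    have "Q\<^sup>T * Q = four_block_mat (1\<^sub>m p) (0\<^sub>m p p) (0\<^sub>m p p) (1\<^sub>m p)"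
      unfolding Qt unfolding Q_def using r(1,2,4)
      by (subst mult_four_block_mat[of _ p p _ p _ p _ _ p _ p]) auto
    also have "\<dots> = 1\<^sub>m ?n" by (simp add: mult_2)
    finally have "Q\<^sup>T * Q = 1\<^sub>m ?n" .
    moreover have "det Q = 1"
      unfolding Q_def using r(1) \<rho>
      by (subst det_four_block_mat_lower_left_zero[of _ p _ p]) (auto simp: special_orthogonal_def)
    ultimately show ?thesis using Qc by (simp add: special_orthogonal_def)
  qed
  note q' = special_orthogonal_inv[OF Q]
  have neg_zero: "- 0\<^sub>m p p = (0\<^sub>m p p :: real mat)" by (rule eq_matI) auto
  have "mat_inv Q * J0 p * Q = four_block_mat (0\<^sub>m p p) (- mat_inv \<rho>) \<rho> (0\<^sub>m p p)"
    unfolding q'(2) r(2) Qt unfolding Q_def J0_def using r(1)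
    by (simp add: mult_four_block_mat[of _ p p _ p _ p _ _ p _ p] neg_zero)
  then have "adapted_matrix p \<rho> P = mat_inv P * (mat_inv Q * J0 p * Q) * P"
    by (simp add: adapted_matrix_def)
  also have "\<dots> = (mat_inv P * mat_inv Q) * J0 p * (Q * P)"
    using q(1,3) q'(1,3) by (simp add: assoc_mult_mat[of _ ?n ?n _ ?n _ ?n] mult_carrier_mat[of _ ?n ?n _ ?n])
  also have "mat_inv P * mat_inv Q = mat_inv (Q * P)"
    unfolding special_orthogonal_inv(2)[OF special_orthogonal_mult[OF Q P]] q(2) q'(2)
    using q(1) q'(1) by (simp add: transpose_mult[of _ ?n ?n _ ?n])
  finally show ?thesis
    using special_orthogonal_mult[OF Q P] by (auto simp: positive_hermitian_def)
qed

definition rotation :: "real \<Rightarrow> real \<Rightarrow> real mat" where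
  "rotation c s = mat 2 2 (\<lambda>(i, j). if i = j then c else if i < j then - s else s)"

lemma rotation_special_orthogonal:
  assumes "c\<^sup>2 + s\<^sup>2 = 1"
  shows "rotation c s \<in> special_orthogonal 2"
proof -
  have c: "rotation c s \<in> carrier_mat 2 2" by (simp add: rotation_def)
  have "(rotation c s)\<^sup>T * rotation c s = 1\<^sub>m 2"
    by (rule eq_matI) (use assms in \<open>auto simp: rotation_def scalar_prod_def less_2_cases_iff power2_eq_square numeral_2_eq_2 algebra_simps\<close>)
  then show ?thesis
    using assms det_2x2[OF c] c by (simp add: special_orthogonal_def rotation_def power2_eq_square)
qed

text \<open>The matrix that sends $e_j$ to $e_{f(j)}$.\<close>
definition permutation_matrix :: "nat \<Rightarrow> (nat \<Rightarrow> nat) \<Rightarrow> real mat" where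
  "permutation_matrix n f = mat n n (\<lambda>(i, j). if i = f j then 1 else 0)"

lemma permutation_matrix_carrier [simp]: "permutation_matrix n f \<in> carrier_mat n n"
  by (simp add: permutation_matrix_def)

lemma permutation_matrix_dim [simp]:
  "dim_row (permutation_matrix n f) = n" "dim_col (permutation_matrix n f) = n"
  by (simp_all add: permutation_matrix_def)

lemma permutation_matrix_entry:
  "i < n \<Longrightarrow> j < n \<Longrightarrow> permutation_matrix n f $$ (i, j) = (if i = f j then 1 else 0)"
  by (simp add: permutation_matrix_def)

lemma permutation_matrix_conjugate:
  assumes f: "f permutes {0..<n}" and M: "M \<in> carrier_mat n n" and kl: "k < n" "l < n"
  shows "((permutation_matrix n f)\<^sup>T * M * permutation_matrix n f) $$ (k, l) = M $$ (f k, f l)"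
proof -
  have f_less: "f j < n" if "j < n" for j using permutes_in_image[OF f, of j] that by simp
  have PM: "((permutation_matrix n f)\<^sup>T * M) $$ (k, j) = M $$ (f k, j)" if "j < n" for j
  proof -
    have "((permutation_matrix n f)\<^sup>T * M) $$ (k, j)
        = (\<Sum>i\<in>{0..<n}. if i = f k then M $$ (i, j) else 0)"
      using M kl that by (simp add: permutation_matrix_def scalar_prod_def if_distrib[of "\<lambda>u. u * _"] cong: if_cong)
    then show ?thesis using f_less[OF kl(1)] by simp
  qed
  have "((permutation_matrix n f)\<^sup>T * M * permutation_matrix n f) $$ (k, l)
      = (\<Sum>j\<in>{0..<n}. ((permutation_matrix n f)\<^sup>T * M) $$ (k, j) * permutation_matrix n f $$ (j, l))"
    using M kl permutation_matrix_carrier[of n f]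
    by (subst index_mult_mat(1)) (auto simp: scalar_prod_def simp del: permutation_matrix_carrier intro!: sum.cong)
  also have "\<dots> = (\<Sum>j\<in>{0..<n}. if j = f l then M $$ (f k, j) else 0)"
    using kl permutation_matrix_entry[of _ n l f] by (intro sum.cong) (auto simp: PM simp del: index_mult_mat(1))
  also have "\<dots> = M $$ (f k, f l)" using f_less[OF kl(2)] by simp
  finally show ?thesis .
qed

text \<open>
  Orthogonality is the conjugation rule applied to the identity matrix, and the determinant is the
  sign of the permutation.
\<close>
lemma permutation_matrix_special_orthogonal:
  assumes f: "f permutes {0..<n}" and even: "evenperm f"
  shows "permutation_matrix n f \<in> special_orthogonal n"
proof -
  let ?P = "permutation_matrix n f"
  have f_less: "f j < n" if "j < n" for j using permutes_in_image[OF f, of j] that by simp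
  have "?P\<^sup>T * ?P = ?P\<^sup>T * 1\<^sub>m n * ?P"
    by (subst right_mult_one_mat[of _ n n]) simp_all
  also have "\<dots> = 1\<^sub>m n"
    by (rule eq_matI)
      (auto simp: permutation_matrix_conjugate[OF f] f_less inj_eq[OF permutes_inj[OF f]]
        simp del: index_mult_mat(1) right_mult_one_mat right_mult_one_mat')
  finally have "?P\<^sup>T * ?P = 1\<^sub>m n" .
  moreover have "det ?P = 1"
  proof -
    have "?P\<^sup>T = mat n n (\<lambda>(i, j). 1\<^sub>m n $$ (f i, j))"
      by (rule eq_matI) (auto simp: permutation_matrix_def f_less)
    then have "det (?P\<^sup>T) = of_int (sign f)"
      using det_permute_rows[OF one_carrier_mat[of n] f, where 'a = real] by simp
    then show ?thesis
      using even by (simp add: det_transpose[of _ n] sign_def)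
  qed
  ultimately show ?thesis by (simp add: special_orthogonal_def)
qed

lemma signed_permutation_permutation_matrix:
  assumes f: "f permutes {0..<n}"
  shows "signed_permutation n (permutation_matrix n f)"
proof -
  note entry = permutation_matrix_entry[of _ n _ f]
  have col: "\<exists>!i. i < n \<and> permutation_matrix n f $$ (i, j) \<noteq> 0" if "j < n" for j
  proof (rule ex1I)
    show "f j < n \<and> permutation_matrix n f $$ (f j, j) \<noteq> 0"
      using permutes_in_image[OF f, of j] that by (simp add: entry)
    show "i = f j" if "i < n \<and> permutation_matrix n f $$ (i, j) \<noteq> 0" for i
      using that \<open>j < n\<close> by (auto simp: entry split: if_splits)
  qed
  have row: "\<exists>!j. j < n \<and> permutation_matrix n f $$ (i, j) \<noteq> 0" if "i < n" for i
  proof -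
    obtain j where j: "f j = i" using permutes_surj[OF f] by (metis surjD)
    show ?thesis
    proof (rule ex1I)
      show "j < n \<and> permutation_matrix n f $$ (i, j) \<noteq> 0"
        using permutes_in_image[OF f, of j] that j by (simp add: entry)
      show "j' = j" if "j' < n \<and> permutation_matrix n f $$ (i, j') \<noteq> 0" for j'
        using that \<open>i < n\<close> j injD[OF permutes_inj[OF f]] by (auto simp: entry split: if_splits)
    qed
  qed
  show ?thesis
    unfolding signed_permutation_def using row col by (simp add: entry)
qed

text \<open>
  For the rotation with cosine $\sqrt t$ and sine $\sqrt{1-t}$, the top row of the block matrix
  with blocks $-\rho^{-1}$ and $\rho$ is $(0,0,-\sqrt t,-\sqrt{1-t})$. Conjugation by the
  permutation matrix of \<open>f\<close> rearranges this row, and \<open>f\<close> fixes $0$ so that it remains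
  the top row.
\<close>
lemma adapted_hermitian_with_two_weights:
  assumes t: "0 \<le> t" "t \<le> 1" and f: "f permutes {0..<4}" "evenperm f" "f 0 = 0"
  obtains J where "J \<in> adapted_hermitian 2" "\<And>j. j < 4 \<Longrightarrow> (J $$ (0, j))\<^sup>2 = [0, 0, t, 1 - t] ! f j"
proof -
  let ?c = "sqrt t" and ?s = "sqrt (1 - t)"
  have cs: "?c\<^sup>2 + ?s\<^sup>2 = 1" using t by simp
  define \<rho> where "\<rho> = rotation ?c ?s"
  have rot: "\<rho> \<in> special_orthogonal 2" unfolding \<rho>_def by (rule rotation_special_orthogonal[OF cs])
  let ?P = "permutation_matrix 4 f"
  have P: "?P \<in> special_orthogonal (2 * 2)"
    using permutation_matrix_special_orthogonal[OF f(1,2)] by simp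
  let ?J = "adapted_matrix 2 \<rho> ?P"
  show thesis
  proof
    show "?J \<in> adapted_hermitian 2"
      using adapted_matrix_positive_hermitian[OF rot P] rot P
        signed_permutation_permutation_matrix[OF f(1)]
      by (auto simp: adapted_hermitian_def)
    fix j :: nat assume j: "j < 4"
    define M where "M = four_block_mat (0\<^sub>m 2 2) (- \<rho>\<^sup>T) \<rho> (0\<^sub>m 2 2)"
    have Mc: "M \<in> carrier_mat 4 4"
      unfolding M_def using special_orthogonal_inv(1)[OF rot] four_block_carrier_mat[of "0\<^sub>m 2 2" 2 2 "0\<^sub>m 2 2" 2 2] by simp
    have "?J = ?P\<^sup>T * M * ?P"
      unfolding adapted_matrix_def M_def special_orthogonal_inv(2)[OF rot] special_orthogonal_inv(2)[OF P] ..
    then have "?J $$ (0, j) = M $$ (0, f j)"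
      using permutation_matrix_conjugate[OF f(1) Mc _ j, of 0] f(3) by simp
    moreover have "(M $$ (0, k))\<^sup>2 = [0, 0, t, 1 - t] ! k" if "k < 4" for k
    proof -
      have "k = 0 \<or> k = 1 \<or> k = 2 \<or> k = 3" using that by auto
      then show ?thesis using t by (auto simp: M_def \<rho>_def rotation_def)
    qed
    ultimately show "(?J $$ (0, j))\<^sup>2 = [0, 0, t, 1 - t] ! f j"
      using permutes_in_image[OF f(1), of j] j by simp
  qed
qed

section \<open>Convex combinations of three numbers\<close>

lemma between_is_convex_combination:
  fixes u v w :: real
  assumes "u \<le> w \<and> w \<le> v \<or> v \<le> w \<and> w \<le> u"
  shows "\<exists>t. 0 \<le> t \<and> t \<le> 1 \<and> w = t * u + (1 - t) * v"
proof (cases "u = v")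
  case True
  then show ?thesis using assms by (intro exI[of _ 0]) auto
next
  case False
  then show ?thesis
    using assms by (intro exI[of _ "(w - v) / (u - v)"]) (auto simp: divide_simps, auto simp: algebra_simps)
qed

text \<open>
  The combination lies between the least and the greatest of the three numbers, so between two of
  them. The three candidates run through the pairs cyclically because the weights that adapted
  structures provide are the cyclic shifts of $(t,1-t,0)$.
\<close>
lemma convex_combination_of_three:
  fixes a b c x y z :: real
  assumes "a \<ge> 0" "b \<ge> 0" "c \<ge> 0" "a + b + c = 1"
  obtains t where "0 \<le> t" "t \<le> 1"
    "a * x + b * y + c * z \<in> {t * x + (1 - t) * y, t * y + (1 - t) * z, t * z + (1 - t) * x}"
proof -
  define w where "w = a * x + b * y + c * z"
  have lo: "min x (min y z) \<le> w"
  proof -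
    let ?m = "min x (min y z)"
    have "?m = a * ?m + b * ?m + c * ?m" using assms(4) by (simp add: distrib_right[symmetric])
    also have "\<dots> \<le> w" unfolding w_def using assms(1-3) by (intro add_mono mult_left_mono) auto
    finally show ?thesis .
  qed
  have hi: "w \<le> max x (max y z)"
  proof -
    let ?m = "max x (max y z)"
    have "w \<le> a * ?m + b * ?m + c * ?m" unfolding w_def using assms(1-3) by (intro add_mono mult_left_mono) auto
    also have "\<dots> = ?m" using assms(4) by (simp add: distrib_right[symmetric])
    finally show ?thesis .
  qed
  have "(x \<le> w \<and> w \<le> y \<or> y \<le> w \<and> w \<le> x) \<or> (y \<le> w \<and> w \<le> z \<or> z \<le> w \<and> w \<le> y)
      \<or> (z \<le> w \<and> w \<le> x \<or> x \<le> w \<and> w \<le> z)"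
    using lo hi by linarith
  then show thesis
    using between_is_convex_combination[of x w y] between_is_convex_combination[of y w z]
      between_is_convex_combination[of z w x] that unfolding w_def by blast
qed

section \<open>The image of the frequency mapping\<close>

lemma three_cycle:
  fixes a b c :: nat
  assumes "distinct [a, b, c]" "{a, b, c} \<subseteq> A"
  defines "f \<equiv> transpose a b \<circ> transpose b c"
  shows "f permutes A" "evenperm f" "f a = b" "f b = c" "f c = a" "x \<notin> {a, b, c} \<Longrightarrow> f x = x"
proof -
  show "f permutes A"
    unfolding f_def using assms(2) by (intro permutes_compose permutes_swap_id) auto
  show "evenperm f"
    unfolding f_def using assms(1)
    by (subst evenperm_comp) (auto simp: evenperm_swap permutation_swap_id)
qed (use assms(1) in \<open>auto simp: f_def transpose_def\<close>)

theorem corollary9: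
  fixes \<sigma>1 \<sigma>2 \<sigma>3 \<sigma>4 :: real and S0 :: "real mat"
  assumes "\<sigma>1 \<ge> 0" "\<sigma>2 \<ge> 0" "\<sigma>3 \<ge> 0" "\<sigma>4 \<ge> 0"
    and "S0 = mat_diag 4 (\<lambda>i. [\<sigma>1, \<sigma>2, \<sigma>3, \<sigma>4] ! i)"
  shows "frequency_map 2 S0 ` positive_hermitian 2 = frequency_map 2 S0 ` adapted_hermitian 2"
proof
  show "frequency_map 2 S0 ` adapted_hermitian 2 \<subseteq> frequency_map 2 S0 ` positive_hermitian 2"
    by (auto simp: adapted_hermitian_def)
  show "frequency_map 2 S0 ` positive_hermitian 2 \<subseteq> frequency_map 2 S0 ` adapted_hermitian 2"
  proof (rule image_subsetI)
    fix J assume J: "J \<in> positive_hermitian 2"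
    define \<sigma> where "\<sigma> = (\<lambda>i. [\<sigma>1, \<sigma>2, \<sigma>3, \<sigma>4] ! i)"
    define a b c where "a = (J $$ (0, 1))\<^sup>2" and "b = (J $$ (0, 2))\<^sup>2" and "c = (J $$ (0, 3))\<^sup>2"
    have "a \<ge> 0" "b \<ge> 0" "c \<ge> 0" "a + b + c = 1"
      using positive_hermitian_4_entries(1)[OF J] by (simp_all add: a_def b_def c_def)
    then obtain t where t: "0 \<le> t" "t \<le> 1"
      and "pairing_value \<sigma> a b c \<in>
        {pairing_value \<sigma> t (1 - t) 0, pairing_value \<sigma> 0 t (1 - t), pairing_value \<sigma> (1 - t) 0 t}"
      unfolding pairing_value_def
      by (rule convex_combination_of_three[of a b c "(\<sigma> 0 + \<sigma> 1) * (\<sigma> 2 + \<sigma> 3)"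
            "(\<sigma> 0 + \<sigma> 2) * (\<sigma> 1 + \<sigma> 3)" "(\<sigma> 0 + \<sigma> 3) * (\<sigma> 1 + \<sigma> 2)"]) auto
    (* One even permutation for each of the three possible positions of the zero weight. *)
    moreover have "\<exists>f. f permutes {0..<4} \<and> evenperm f \<and> f 0 = 0 \<and> f 1 = 2 \<and> f 2 = 3 \<and> f 3 = (1::nat)"
      using three_cycle[of 1 2 3 "{0..<4}"] by (intro exI[of _ "transpose 1 2 \<circ> transpose 2 3"]) auto
    moreover have "\<exists>f. f permutes {0..<4} \<and> evenperm f \<and> f 0 = 0 \<and> f 1 = 3 \<and> f 3 = 2 \<and> f 2 = (1::nat)"
      using three_cycle[of 1 3 2 "{0..<4}"] by (intro exI[of _ "transpose 1 3 \<circ> transpose 3 2"]) auto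
    moreover have "\<exists>f. f permutes {0..<4} \<and> evenperm f \<and> f 0 = 0 \<and> f 1 = 1 \<and> f 2 = 2 \<and> f 3 = (3::nat)"
      by (intro exI[of _ id]) (auto simp: permutes_id)
    ultimately obtain f where f: "f permutes {0..<4}" "evenperm f" "f 0 = 0"
      and val: "pairing_value \<sigma> a b c = pairing_value \<sigma> ([0, 0, t, 1 - t] ! f 1)
                  ([0, 0, t, 1 - t] ! f 2) ([0, 0, t, 1 - t] ! f 3)"
      by auto
    obtain J' where J': "J' \<in> adapted_hermitian 2" "\<And>j. j < 4 \<Longrightarrow> (J' $$ (0, j))\<^sup>2 = [0, 0, t, 1 - t] ! f j"
      using adapted_hermitian_with_two_weights[OF t f] by blast
    have J'_pos: "J' \<in> positive_hermitian 2" using J'(1) by (simp add: adapted_hermitian_def)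
    have "frequency_map 2 S0 J = frequency_map 2 S0 J'"
      unfolding assms(5) \<sigma>_def[symmetric] frequency_map_4[OF J] frequency_map_4[OF J'_pos]
      using val unfolding a_def b_def c_def by (simp add: J'(2))
    then show "frequency_map 2 S0 J \<in> frequency_map 2 S0 ` adapted_hermitian 2"
      using J'(1) by blast
  qed
qed

end
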